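(* For every $b>1$, the deterministic $b$-scaling strategy $D_b$ is $\left(1+\frac{2b^{3/2}}{b-1}\right)$-competitive for single-machine scheduling minimizing $\sum_j w_jC_j$ in the non-clairvoyant kill-and-restart model, i.e., $D_b(I)\leq \left(1+\frac{2b^{3/2}}{b-1}\right)\mathrm{OPT}(I)$ for every instance $I$. In particular, this bound is minimized for $b=3$, where it equals $1+3\sqrt{3}\approx 6.196$.
   Context: An instance $I=(\vec p,\vec w)$ consists of $n$ jobs with processing times $p_j>0$ and weights $w_j>0$, to be processed on a single machine; the objective is $\sum_j w_jC_j$. $\mathrm{OPT}(I)$ is the optimal clairvoyant objective value (attained by non-preemptively processing jobs in nondecreasing order of $p_j/w_j$). Kill-and-restart model: the (non-clairvoyant) strategy does not know $p_j$ until $j$ completes; it probes unfinished jobs one at a time, a probing of job $j$ for time $\tau$ completes $j$ after $p_j$ time units if $\tau\geq p_j$, and otherwise is aborted after $\tau$ time units with all progress lost. The $b$-scaling strategy $D_b$: proceed in rounds $q\in\mathbb{Z}$ (all integers, in increasing order, starting from $-\infty$); in round $q$, every job not yet completed is probed, in order of increasing index, for time $w_jb^q$, and removed once completed; probings are executed back to back from time $0$ without idling. Formally, $D_b$ is the limit as $q_0\to-\infty$ of the algorithm that starts with round $q_0$; in particular, when round $q$ starts, every unfinished job $j$ has been probed for a total of $\sum_{i<q}w_jb^i=w_jb^q/(b-1)$. $D_b(I)$ is the objective value of its schedule. *)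

theory Defs
  imports Complex_Main
begin

text \<open>The jobs of an instance are the indices below \<open>num_jobs\<close>; the values of \<open>ptime\<close> and
  \<open>weight\<close> elsewhere are irrelevant.\<close>

record job_instance =
  num_jobs :: nat
  ptime :: "nat \<Rightarrow> real"
  weight :: "nat \<Rightarrow> real"

definition valid_instance :: "job_instance \<Rightarrow> bool" where
  "valid_instance I \<longleftrightarrow> (\<forall>j<num_jobs I. ptime I j > 0 \<and> weight I j > 0)"

definition objective :: "job_instance \<Rightarrow> (nat \<Rightarrow> real) \<Rightarrow> real" where
  "objective I C = (\<Sum>j<num_jobs I. weight I j * C j)"


text \<open>A clairvoyant schedule is given by the start times of the successful (uninterrupted) runs of
  the jobs. Idle time is allowed, so that every clairvoyant schedule with kills and restarts is
  covered as well: its aborted probings just become idle time.\<close>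

definition feasible_schedule :: "job_instance \<Rightarrow> (nat \<Rightarrow> real) \<Rightarrow> bool" where
  "feasible_schedule I S \<longleftrightarrow>
     (\<forall>j<num_jobs I. 0 \<le> S j) \<and>
     (\<forall>j<num_jobs I. \<forall>k<num_jobs I. j \<noteq> k \<longrightarrow>
        S j + ptime I j \<le> S k \<or> S k + ptime I k \<le> S j)"

definition OPT :: "job_instance \<Rightarrow> real" where
  "OPT I = (INF S \<in> {S. feasible_schedule I S}. objective I (\<lambda>j. S j + ptime I j))"


text \<open>A state of the machine consists of the current time and the completion times of the jobs
  completed so far. Requests to probe an already completed job are skipped and take no time.\<close>

type_synonym machine_state = "real \<times> (nat \<Rightarrow> real option)"

definition probe :: "job_instance \<Rightarrow> nat \<times> real \<Rightarrow> machine_state \<Rightarrow> machine_state" where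
  "probe I = (\<lambda>(j, \<tau>) (t, C).
     if C j \<noteq> None then (t, C)
     else if ptime I j \<le> \<tau> then (t + ptime I j, C(j \<mapsto> t + ptime I j))
     else (t + \<tau>, C))"

definition scaling_round :: "real \<Rightarrow> job_instance \<Rightarrow> int \<Rightarrow> (nat \<times> real) list" where
  "scaling_round b I q = map (\<lambda>j. (j, weight I j * b powi q)) [0..<num_jobs I]"

text \<open>The state after the \<open>m\<close> rounds \<open>q\<^sub>0, \<dots>, q\<^sub>0 + m - 1\<close> of the algorithm that starts with round
  \<open>q\<^sub>0\<close> at time \<open>0\<close>.\<close>

primrec scaling_run :: "real \<Rightarrow> job_instance \<Rightarrow> int \<Rightarrow> nat \<Rightarrow> machine_state" where
  "scaling_run b I q\<^sub>0 0 = (0, \<lambda>_. None)"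
| "scaling_run b I q\<^sub>0 (Suc m) =
     fold (probe I) (scaling_round b I (q\<^sub>0 + int m)) (scaling_run b I q\<^sub>0 m)"

text \<open>Recorded completion times never change, and for \<open>b > 1\<close> every job of a valid instance is
  eventually completed, so the description below is proper.\<close>

definition truncated_completion :: "real \<Rightarrow> job_instance \<Rightarrow> int \<Rightarrow> nat \<Rightarrow> real" where
  "truncated_completion b I q\<^sub>0 j = (THE c. \<exists>m. snd (scaling_run b I q\<^sub>0 m) j = Some c)"

definition scaling_completion :: "real \<Rightarrow> job_instance \<Rightarrow> nat \<Rightarrow> real" where
  "scaling_completion b I j = Lim at_bot (\<lambda>q\<^sub>0. truncated_completion b I q\<^sub>0 j)"

definition scaling_strategy :: "real \<Rightarrow> job_instance \<Rightarrow> real" where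
  "scaling_strategy b I = objective I (scaling_completion b I)"


text \<open>A strategy is represented by the objective value that it achieves on each instance.\<close>

definition competitive :: "real \<Rightarrow> (job_instance \<Rightarrow> real) \<Rightarrow> bool" where
  "competitive c alg \<longleftrightarrow> (\<forall>I. valid_instance I \<longrightarrow> alg I \<le> c * OPT I)"

definition scaling_bound :: "real \<Rightarrow> real" where
  "scaling_bound b = 1 + 2 * b powr (3/2) / (b - 1)"

end

theory Submission
  imports Defs
begin

text \<open>Write \<open>s\<^sub>j = p\<^sub>j / w\<^sub>j\<close>, and let \<open>q\<^sub>j\<close> be the round in which \<open>j\<close> completes, so that
  \<open>b powi (q\<^sub>j - 1) < s\<^sub>j \<le> b powi q\<^sub>j\<close>. Both sides of the claim are quadratic forms in the weights. In an
  optimal schedule the mutual delay of two jobs costs \<open>w\<^sub>j w\<^sub>k min s\<^sub>j s\<^sub>k\<close>; the scaling strategy pays in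
  addition at most \<open>w\<^sub>j w\<^sub>k\<close> times the excess defined below. A comparison pair by pair only gives the
  ratio \<open>1 + b (b + 1) / (b - 1)\<close>, so the two forms are compared as a whole. The difference is convex
  in each \<open>s\<^sub>j\<close>, which reduces the comparison to \<open>s\<^sub>j = b powi (q\<^sub>j - 1)\<close>. There, rescaling \<open>w\<^sub>j\<close> by
  \<open>sqrt b powi q\<^sub>j\<close> turns the excess into a Toeplitz form in \<open>q\<^sub>j - q\<^sub>k\<close> with geometrically decaying
  entries, whose norm is at most the row sum \<open>2 / (sqrt b - 1)\<close>.\<close>

section \<open>Comparison of quadratic forms\<close>

text \<open>The worst case over the order of the two indices: the job that completes later comes first and
  wastes one more probing in the last round of the other job.\<close>

definition excess :: "real \<Rightarrow> int \<Rightarrow> real \<Rightarrow> int \<Rightarrow> real \<Rightarrow> real" where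
  "excess b q s q' s' =
     2 * b powi min q q' / (b - 1) + (if q = q' then \<bar>s - s'\<bar> else b powi min q q')"

lemma excess_commute: "excess b q s q' s' = excess b q' s' q s"
  by (simp add: excess_def min.commute abs_minus_commute)

section \<open>Convexity of the gap in a single ratio\<close>

lemma powi_mono_base_gt_1:
  fixes b :: real assumes "b > 1" "m \<le> n" shows "b powi m \<le> b powi n"
  using assms by (intro power_int_increasing) auto

text \<open>The diagonal is treated apart because both arguments of the kernel move together. The
  excess there depends on the round alone and \<open>c * s\<close> is linear, so the only change is
  from \<open>V\<close> to the larger \<open>W\<close>, with coefficient \<open>l\<close>.\<close>

lemma gap_kernel_diag_le:
  fixes b :: real
  assumes b: "b > 1" and l: "0 \<le> l" "l \<le> 1"
    and s: "s = (1 - l) * b powi (q - 1) + l * b powi q"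
  shows "excess b q s q s - c * s
    \<le> (1 - l) * (excess b q (b powi (q - 1)) q (b powi (q - 1)) - c * b powi (q - 1))
      + l * (excess b (q + 1) (b powi q) (q + 1) (b powi q) - c * b powi q)"
proof -
  define V where "V = 2 * b powi q / (b - 1)"
  define W where "W = 2 * b powi (q + 1) / (b - 1)"
  have e: "excess b q x q x = V" "excess b (q + 1) x (q + 1) x = W" for x
    by (simp_all add: excess_def V_def W_def)
  have "V \<le> W"
    using b unfolding V_def W_def by (intro divide_right_mono mult_left_mono powi_mono_base_gt_1) auto
  then have "l * V \<le> l * W" using l by (intro mult_left_mono) auto
  then show ?thesis
    unfolding e by (simp add: s algebra_simps)
qed

text \<open>Within one round the kernel is convex in \<open>s\<close>: the excess is constant or
  \<open>\<bar>s - s'\<bar>\<close>, and \<open>- c * min s s'\<close> is convex as \<open>c\<close>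
  is nonnegative. It remains to check that the right endpoint may be charged to round
  \<open>q + 1\<close>, which the cases on \<open>q'\<close> do.\<close>

lemma gap_kernel_le:
  fixes b c :: real
  assumes b: "b > 1" and c: "c \<ge> 0" and l: "0 \<le> l" "l \<le> 1"
    and s: "s = (1 - l) * b powi (q - 1) + l * b powi q"
    and s': "b powi (q' - 1) \<le> s'" "s' \<le> b powi q'"
  shows "excess b q s q' s' - c * min s s'
    \<le> (1 - l) * (excess b q (b powi (q - 1)) q' s' - c * min (b powi (q - 1)) s')
      + l * (excess b (q + 1) (b powi q) q' s' - c * min (b powi q) s')"
proof -
  define X where "X = b powi (q - 1)"
  define Y where "Y = b powi q"
  define Z where "Z = b powi (q + 1)"
  have Y: "Y = b * X" and Z: "Z = b * Y"
    using b by (simp_all add: X_def Y_def Z_def power_int_diff power_int_add)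
  have X0: "X > 0" using b by (simp add: X_def)
  have XY: "X \<le> Y" and YZ: "Y \<le> Z"
    using b by (auto simp: X_def Y_def Z_def intro!: powi_mono_base_gt_1)
  define V where "V = 2 * Y / (b - 1)"
  have ZY: "2 * Z / (b - 1) = V + 2 * Y"
    using b by (simp add: Z V_def field_simps)
  have sX: "s = (1 - l) * X + l * Y" using s by (simp add: X_def Y_def)
  have Xs: "X \<le> s"
    using mult_left_mono[OF XY l(1)] by (simp add: sX algebra_simps)
  have sY: "s \<le> Y"
    using mult_left_mono[OF XY, of "1 - l"] l by (simp add: sX algebra_simps)
  consider "q' < q" | "q' = q" | "q' = q + 1" | "q' > q + 1" by linarith
  then show ?thesis
  proof cases
    case 1
    have "s' \<le> X"
      using s'(2) powi_mono_base_gt_1[OF b, of q' "q - 1"] 1 by (simp add: X_def)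
    then have m: "min s s' = s'" "min X s' = s'" "min Y s' = s'"
      using Xs XY by auto
    define W where "W = 2 * b powi q' / (b - 1) + b powi q'"
    have e: "excess b q s q' s' = W" "excess b q X q' s' = W" "excess b (q + 1) Y q' s' = W"
      using 1 by (simp_all add: excess_def W_def)
    show ?thesis
      unfolding X_def[symmetric] Y_def[symmetric] m e by (simp add: algebra_simps)
  next
    case 2
    have s'X: "X \<le> s'" "s' \<le> Y" using s' 2 by (simp_all add: X_def Y_def)
    have "(1 - l) * X + l * s' \<le> s"
      using mult_left_mono[OF s'X(2) l(1)] by (simp add: sX)
    moreover have "(1 - l) * X + l * s' \<le> s'"
      using mult_left_mono[OF s'X(1), of "1 - l"] l by (simp add: algebra_simps)
    ultimately have "(1 - l) * X + l * s' \<le> min s s'" by simp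
    from mult_left_mono[OF this c]
    have A: "(1 - l) * (c * X) + l * (c * s') \<le> c * min s s'" by (simp add: algebra_simps)
    have "s - s' = (1 - l) * (X - s') + l * (Y - s')" by (simp add: sX algebra_simps)
    then have "\<bar>s - s'\<bar> \<le> \<bar>(1 - l) * (X - s')\<bar> + \<bar>l * (Y - s')\<bar>"
      using abs_triangle_ineq by metis
    also have "\<dots> = (1 - l) * \<bar>X - s'\<bar> + l * (Y - s')"
      using l s'X by (simp add: abs_mult)
    \<comment> \<open>Once the moved job belongs to round \<open>q + 1\<close>, the two rounds
      differ, and the excess contains all of \<open>Y\<close> in place of
      \<open>Y - s'\<close>.\<close>
    also have "\<dots> \<le> (1 - l) * \<bar>X - s'\<bar> + l * Y"
      using l s'X X0 by (intro add_left_mono mult_left_mono) auto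
    finally have B: "\<bar>s - s'\<bar> \<le> (1 - l) * \<bar>X - s'\<bar> + l * Y" .
    have "excess b q s q' s' - c * min s s' = V + \<bar>s - s'\<bar> - c * min s s'"
      using 2 by (simp add: excess_def Y_def V_def)
    also have "\<dots> \<le> (1 - l) * (V + \<bar>X - s'\<bar> - c * X) + l * (V + Y - c * s')"
      using A B by (simp add: algebra_simps)
    also have "\<dots> = (1 - l) * (excess b q X q' s' - c * min X s')
                    + l * (excess b (q + 1) Y q' s' - c * min Y s')"
      using 2 s'X by (simp add: excess_def Y_def[symmetric] V_def min_def)
    finally show ?thesis by (simp add: X_def Y_def)
  next
    case 3
    have s'Y: "Y \<le> s'" using s'(1) 3 by (simp add: Y_def)
    have "excess b q s q' s' - c * min s s' = V + Y - c * s"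
      using 3 sY s'Y by (simp add: excess_def Y_def[symmetric] V_def min_def)
    also have "\<dots> = (1 - l) * (V + Y - c * X) + l * (V + Y - c * Y)"
      by (simp add: sX algebra_simps)
    \<comment> \<open>The move makes the two rounds coincide, so the term \<open>Y\<close> for
      distinct rounds is lost; the growth of the first term of the excess by \<open>2 * Y\<close>
      makes up for it.\<close>
    also have "\<dots> \<le> (1 - l) * (V + Y - c * X)
                    + l * (2 * Z / (b - 1) + \<bar>Y - s'\<bar> - c * Y)"
      using l X0 XY by (intro add_left_mono mult_left_mono) (auto simp: ZY)
    also have "\<dots> = (1 - l) * (excess b q X q' s' - c * min X s')
                    + l * (excess b (q + 1) Y q' s' - c * min Y s')"
      using 3 s'Y XY by (simp add: excess_def Y_def[symmetric] Z_def[symmetric] V_def min_def)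
    finally show ?thesis by (simp add: X_def Y_def)
  next
    case 4
    have "Y \<le> s'"
      using s'(1) powi_mono_base_gt_1[OF b, of q "q' - 1"] 4 by (simp add: Y_def)
    then have m: "min s s' = s" "min X s' = X" "min Y s' = Y"
      using sY XY by auto
    have "excess b q s q' s' - c * min s s' = V + Y - c * s"
      using 4 m by (simp add: excess_def Y_def[symmetric] V_def)
    also have "\<dots> = (1 - l) * (V + Y - c * X) + l * (V + Y - c * Y)"
      by (simp add: sX algebra_simps)
    also have "\<dots> \<le> (1 - l) * (V + Y - c * X)
                    + l * (2 * Z / (b - 1) + Z - c * Y)"
      using l X0 XY YZ by (intro add_left_mono mult_left_mono) (auto simp: ZY)
    also have "\<dots> = (1 - l) * (excess b q X q' s' - c * min X s')
                    + l * (excess b (q + 1) Y q' s' - c * min Y s')"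
      using 4 m by (simp add: excess_def Y_def[symmetric] Z_def[symmetric] V_def)
    finally show ?thesis by (simp add: X_def Y_def)
  qed
qed

section \<open>Toeplitz forms with geometric decay\<close>

lemma sum_geometric_ints_le:
  fixes r :: real
  assumes "finite Q" and r: "0 < r" "r < 1"
  shows "(\<Sum>q'\<in>Q - {q}. r powi \<bar>q - q'\<bar>) \<le> 2 * (r / (1 - r))"
proof -
  \<comment> \<open>On either side of \<open>q\<close> the distances are distinct positive integers,
    so each side is part of a geometric series without its constant term.\<close>
  have half: "sum (\<lambda>q'. r powi \<bar>q - q'\<bar>) A \<le> r / (1 - r)"
    if "finite A" "inj_on (\<lambda>q'. nat \<bar>q - q'\<bar>) A" "q \<notin> A" for A
  proof -
    let ?f = "\<lambda>q'. nat \<bar>q - q'\<bar>"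
    define N where "N = Max (insert 0 (?f ` A))"
    have "sum (\<lambda>q'. r powi \<bar>q - q'\<bar>) A = sum (\<lambda>q'. r ^ ?f q') A"
      by (intro sum.cong) (auto simp: power_int_def)
    also have "\<dots> = sum (\<lambda>d. r ^ d) (?f ` A)"
      using that(2) by (simp add: sum.reindex)
    also have "\<dots> \<le> sum (\<lambda>d. r ^ d) {1..N}"
    proof (intro sum_mono2)
      show "?f ` A \<subseteq> {1..N}"
      proof (intro image_subsetI)
        fix q' assume q': "q' \<in> A"
        then have "q' \<noteq> q" using that(3) by auto
        moreover have "?f q' \<le> N" using that(1) q' by (simp add: N_def)
        ultimately show "?f q' \<in> {1..N}" by auto
      qed
    qed (use r in auto)
    also have "\<dots> = (r - r ^ Suc N) / (1 - r)"
      using r by (subst sum_gp) (auto simp: power_Suc)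
    also have "\<dots> \<le> r / (1 - r)"
      using r by (intro divide_right_mono) auto
    finally show ?thesis .
  qed
  have "(\<Sum>q'\<in>Q - {q}. r powi \<bar>q - q'\<bar>)
      = (\<Sum>q'\<in>{x\<in>Q. x < q} \<union> {x\<in>Q. q < x}. r powi \<bar>q - q'\<bar>)"
    by (intro sum.cong) auto
  also have "\<dots> = (\<Sum>q'\<in>{x\<in>Q. x < q}. r powi \<bar>q - q'\<bar>) + (\<Sum>q'\<in>{x\<in>Q. q < x}. r powi \<bar>q - q'\<bar>)"
    using assms(1) by (intro sum.union_disjoint) auto
  also have "\<dots> \<le> r / (1 - r) + r / (1 - r)"
    using assms(1) by (intro add_mono half) (auto simp: inj_on_def)
  finally show ?thesis by simp
qed

text \<open>This is the Schur test: the arithmetic-geometric mean inequality splits each product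
  into two squares, the two halves agree by symmetry, and every square is left with its row
  sum.\<close>

lemma sum_powi_abs_diff_le:
  fixes U :: "int \<Rightarrow> real"
  assumes "finite Q" and r: "0 < r" "r < 1"
  shows "(\<Sum>q\<in>Q. \<Sum>q'\<in>Q - {q}. U q * U q' * r powi \<bar>q - q'\<bar>)
    \<le> 2 * (r / (1 - r)) * (\<Sum>q\<in>Q. (U q)\<^sup>2)"
proof -
  let ?g = "\<lambda>q q'. (U q)\<^sup>2 * r powi \<bar>q - q'\<bar>"
  have swap: "(\<Sum>q\<in>Q. \<Sum>q'\<in>Q - {q}. ?g q' q) = (\<Sum>q\<in>Q. \<Sum>q'\<in>Q - {q}. ?g q q')"
  proof -
    \<comment> \<open>Zeros on the diagonal make the inner range independent of \<open>q\<close>, so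
      that the summations can be exchanged.\<close>
    have *: "(\<Sum>q\<in>Q. \<Sum>q'\<in>Q - {q}. h q q') = (\<Sum>q\<in>Q. \<Sum>q'\<in>Q. if q' = q then 0 else h q q')"
      for h :: "int \<Rightarrow> int \<Rightarrow> real"
      using assms(1) by (intro sum.cong refl sum.mono_neutral_cong_left) auto
    show ?thesis
      unfolding * by (subst sum.swap) (intro sum.cong refl, auto)
  qed
  have "(\<Sum>q\<in>Q. \<Sum>q'\<in>Q - {q}. U q * U q' * r powi \<bar>q - q'\<bar>)
    \<le> (\<Sum>q\<in>Q. \<Sum>q'\<in>Q - {q}. (?g q q' + ?g q' q) / 2)"
  proof (intro sum_mono)
    fix q q'
    have "U q * U q' \<le> ((U q)\<^sup>2 + (U q')\<^sup>2) / 2"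
      using sum_squares_bound[of "U q" "U q'"] by simp
    then have "U q * U q' * r powi \<bar>q - q'\<bar> \<le> ((U q)\<^sup>2 + (U q')\<^sup>2) / 2 * r powi \<bar>q - q'\<bar>"
      using r by (intro mult_right_mono) auto
    then show "U q * U q' * r powi \<bar>q - q'\<bar> \<le> (?g q q' + ?g q' q) / 2"
      by (simp add: algebra_simps abs_minus_commute)
  qed
  also have "\<dots> = ((\<Sum>q\<in>Q. \<Sum>q'\<in>Q - {q}. ?g q q') + (\<Sum>q\<in>Q. \<Sum>q'\<in>Q - {q}. ?g q' q)) / 2"
    by (simp add: sum.distrib sum_divide_distrib[symmetric])
  also have "\<dots> = (\<Sum>q\<in>Q. (U q)\<^sup>2 * (\<Sum>q'\<in>Q - {q}. r powi \<bar>q - q'\<bar>))"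
    by (simp only: swap sum_distrib_left) simp
  also have "\<dots> \<le> (\<Sum>q\<in>Q. (U q)\<^sup>2 * (2 * (r / (1 - r))))"
    using assms by (intro sum_mono mult_left_mono sum_geometric_ints_le) auto
  also have "\<dots> = 2 * (r / (1 - r)) * (\<Sum>q\<in>Q. (U q)\<^sup>2)"
    by (simp only: sum_distrib_left mult.commute)
  finally show ?thesis .
qed

text \<open>Jobs of the same round merge into one index, because the kernel sees only rounds.
  Afterwards the indices are distinct, as the geometric bound on row sums requires.\<close>

lemma sum_sum_group:
  fixes u :: "'a \<Rightarrow> real" and q :: "'a \<Rightarrow> 'b"
  assumes "finite J"
  defines "U x \<equiv> sum u {j \<in> J. q j = x}"
  shows "(\<Sum>j\<in>J. \<Sum>k\<in>J. u j * u k * h (q j) (q k)) = (\<Sum>x\<in>q ` J. \<Sum>y\<in>q ` J. U x * U y * h x y)"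
proof -
  have one: "(\<Sum>k\<in>J. u k * g (q k)) = (\<Sum>y\<in>q ` J. U y * g y)" for g
    unfolding U_def sum_distrib_right sum.image_gen[OF assms(1), of _ q] by (intro sum.cong) auto
  have "(\<Sum>j\<in>J. \<Sum>k\<in>J. u j * u k * h (q j) (q k)) = (\<Sum>j\<in>J. u j * (\<Sum>k\<in>J. u k * h (q j) (q k)))"
    by (simp add: sum_distrib_left mult.assoc)
  also have "\<dots> = (\<Sum>x\<in>q ` J. U x * (\<Sum>y\<in>q ` J. U y * h x y))"
    unfolding one[of "h _"] one[of "\<lambda>x. \<Sum>y\<in>q ` J. U y * h x y"] ..
  finally show ?thesis by (simp add: sum_distrib_left mult.assoc)
qed

text \<open>This rests on \<open>2 * min q q' = q + q' - \<bar>q - q'\<bar>\<close>. The first two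
  factors are absorbed into the weights, the third is the Toeplitz kernel.\<close>

lemma powi_min_eq:
  fixes \<beta> :: real
  assumes "\<beta> > 0"
  shows "(\<beta>\<^sup>2) powi min q q' = \<beta> powi q * \<beta> powi q' * (1 / \<beta>) powi \<bar>q - q'\<bar>"
proof -
  have *: "(\<beta>\<^sup>2) powi min x y = \<beta> powi x * \<beta> powi y * (1 / \<beta>) powi \<bar>x - y\<bar>" if "x \<le> y" for x y
  proof -
    have "(1 / \<beta>) powi (y - x) = \<beta> powi (x - y)"
      using power_int_minus[of \<beta> "y - x"] by (simp add: power_int_inverse divide_inverse)
    then have "\<beta> powi y * (1 / \<beta>) powi (y - x) = \<beta> powi x"
      using assms by (simp add: power_int_diff)
    then show ?thesis using that
      by (simp add: power2_eq_square power_int_mult_distrib mult.assoc)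
  qed
  show ?thesis
    using *[of q q'] *[of q' q] by (cases "q \<le> q'") (auto simp: min.commute abs_minus_commute mult.commute)
qed

text \<open>At lower ends, ratios of the same round coincide, so the absolute value vanishes and
  everything is a multiple of \<open>b powi min q q'\<close>. The common coefficient is
  \<open>2 / (b - 1) - 2 * \<beta> / (b - 1) = - 2 / (\<beta> + 1)\<close>.\<close>

lemma aligned_gap_kernel:
  fixes \<beta> :: real
  assumes \<beta>: "\<beta> > 1"
  defines "b \<equiv> \<beta>\<^sup>2"
  shows "excess b q (b powi (q - 1)) q' (b powi (q' - 1))
      - 2 * \<beta> ^ 3 / (b - 1) * min (b powi (q - 1)) (b powi (q' - 1))
    = b powi min q q' * (of_bool (q \<noteq> q') - 2 / (\<beta> + 1))"
proof -
  have b: "b > 1" using \<beta> by (simp add: b_def)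
  have "min (b powi (q - 1)) (b powi (q' - 1)) = b powi (min q q' - 1)"
    using powi_mono_base_gt_1[OF b, of "q - 1" "q' - 1"] powi_mono_base_gt_1[OF b, of "q' - 1" "q - 1"]
    by (auto simp: min_def)
  also have "\<dots> = b powi min q q' / b" using b by (simp add: power_int_diff)
  finally have m: "min (b powi (q - 1)) (b powi (q' - 1)) = b powi min q q' / b" .
  have f: "b - 1 = (\<beta> - 1) * (\<beta> + 1)" by (simp add: b_def power2_eq_square algebra_simps)
  have "\<beta> ^ 3 / b = \<beta>" using \<beta> by (simp add: b_def power3_eq_cube power2_eq_square)
  moreover have "2 * \<beta> ^ 3 / (b - 1) / b = 2 / (b - 1) * (\<beta> ^ 3 / b)" by simp
  ultimately have "2 / (b - 1) - 2 * \<beta> ^ 3 / (b - 1) / b = 2 / (b - 1) * (1 - \<beta>)"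
    by (simp only: right_diff_distrib mult_1_right)
  also have "\<dots> = - 2 / (\<beta> + 1)"
    unfolding f using \<beta> by (simp add: divide_simps)
  finally have "2 * B / (b - 1) - 2 * \<beta> ^ 3 / (b - 1) * (B / b) = B * (- 2 / (\<beta> + 1))" for B
    by (metis (no_types, opaque_lifting) mult.commute right_diff_distrib times_divide_eq_left times_divide_eq_right)
  from this[of "b powi min q q'"] show ?thesis
    unfolding m excess_def by (auto simp: algebra_simps)
qed

text \<open>After rescaling, each diagonal entry is \<open>- \<gamma>\<close> and the off-diagonal
  part is at most \<open>1 - \<gamma>\<close> times the row sum \<open>2 / (\<beta> - 1)\<close>.
  The two cancel exactly; this balance is the origin of the constant
  \<open>2 * \<beta> ^ 3 / (b - 1)\<close>.\<close>

lemma aligned_gap_sum_nonpos: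
  fixes w :: "'a \<Rightarrow> real"
  assumes "finite J" and \<beta>: "\<beta> > 1"
  defines "b \<equiv> \<beta>\<^sup>2"
  shows "(\<Sum>j\<in>J. \<Sum>k\<in>J. w j * w k *
      (excess b (q j) (b powi (q j - 1)) (q k) (b powi (q k - 1))
        - 2 * \<beta> ^ 3 / (b - 1) * min (b powi (q j - 1)) (b powi (q k - 1)))) \<le> 0"
proof -
  define r where "r = 1 / \<beta>"
  have r: "0 < r" "r < 1" using \<beta> by (simp_all add: r_def)
  define u where "u j = w j * \<beta> powi q j" for j
  define U where "U x = sum u {j \<in> J. q j = x}" for x
  define \<gamma> where "\<gamma> = 2 / (\<beta> + 1)"
  define h where "h x y = r powi \<bar>x - y\<bar> * (of_bool (x \<noteq> y) - \<gamma>)" for x y :: int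
  define Q where "Q = q ` J"
  have Q: "finite Q" using assms(1) by (simp add: Q_def)
  have "(\<Sum>j\<in>J. \<Sum>k\<in>J. w j * w k *
      (excess b (q j) (b powi (q j - 1)) (q k) (b powi (q k - 1))
        - 2 * \<beta> ^ 3 / (b - 1) * min (b powi (q j - 1)) (b powi (q k - 1))))
    = (\<Sum>j\<in>J. \<Sum>k\<in>J. u j * u k * h (q j) (q k))"
    using \<beta> unfolding b_def aligned_gap_kernel[OF \<beta>]
    by (intro sum.cong refl) (simp add: powi_min_eq u_def h_def \<gamma>_def r_def)
  also have "\<dots> = (\<Sum>x\<in>Q. \<Sum>y\<in>Q. U x * U y * h x y)"
    unfolding U_def Q_def by (rule sum_sum_group[OF assms(1)])
  also have "\<dots> = (\<Sum>x\<in>Q. (1 - \<gamma>) * (\<Sum>y\<in>Q - {x}. U x * U y * r powi \<bar>x - y\<bar>) - \<gamma> * (U x)\<^sup>2)"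
  proof (intro sum.cong refl)
    fix x assume "x \<in> Q"
    then have "(\<Sum>y\<in>Q. U x * U y * h x y) = U x * U x * h x x + (\<Sum>y\<in>Q - {x}. U x * U y * h x y)"
      using Q by (simp add: sum.remove)
    also have "(\<Sum>y\<in>Q - {x}. U x * U y * h x y) = (\<Sum>y\<in>Q - {x}. (1 - \<gamma>) * (U x * U y * r powi \<bar>x - y\<bar>))"
      by (intro sum.cong) (auto simp: h_def)
    finally show "(\<Sum>y\<in>Q. U x * U y * h x y)
        = (1 - \<gamma>) * (\<Sum>y\<in>Q - {x}. U x * U y * r powi \<bar>x - y\<bar>) - \<gamma> * (U x)\<^sup>2"
      by (simp add: sum_distrib_left h_def power2_eq_square)
  qed
  also have "\<dots> = (1 - \<gamma>) * (\<Sum>x\<in>Q. \<Sum>y\<in>Q - {x}. U x * U y * r powi \<bar>x - y\<bar>) - \<gamma> * (\<Sum>x\<in>Q. (U x)\<^sup>2)"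
    by (simp add: sum_subtractf sum_distrib_left)
  also have "\<dots> \<le> (1 - \<gamma>) * (2 * (r / (1 - r)) * (\<Sum>x\<in>Q. (U x)\<^sup>2)) - \<gamma> * (\<Sum>x\<in>Q. (U x)\<^sup>2)"
    using \<beta> by (intro diff_right_mono mult_left_mono sum_powi_abs_diff_le Q r) (simp add: \<gamma>_def)
  also have "\<dots> = ((1 - \<gamma>) * (2 * (r / (1 - r))) - \<gamma>) * (\<Sum>x\<in>Q. (U x)\<^sup>2)"
    by (simp add: left_diff_distrib)
  also have "r / (1 - r) = 1 / (\<beta> - 1)" using \<beta> by (simp add: r_def field_simps)
  also have "1 - \<gamma> = (\<beta> - 1) / (\<beta> + 1)" using \<beta> by (simp add: \<gamma>_def field_simps)
  also have "(\<beta> - 1) / (\<beta> + 1) * (2 * (1 / (\<beta> - 1))) - \<gamma> = 0"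
    using \<beta> by (simp add: \<gamma>_def divide_simps)
  finally show ?thesis by simp
qed

text \<open>The gap is convex in each ratio \<open>s i\<close> separately, so \<open>s i\<close> may be pushed to an end of its
  round's interval. The upper end is the lower end of the next round, and moving \<open>i\<close> there only
  increases the excess. Hence all jobs can be aligned to lower ends.\<close>

lemma gap_sum_nonpos:
  fixes w :: "'a \<Rightarrow> real"
  assumes J: "finite J" and \<beta>: "\<beta> > 1" and w: "\<And>j. j \<in> J \<Longrightarrow> w j \<ge> 0"
  defines "b \<equiv> \<beta>\<^sup>2"
  assumes s: "\<And>j. j \<in> J \<Longrightarrow> b powi (q j - 1) \<le> s j \<and> s j \<le> b powi q j"
  shows "(\<Sum>j\<in>J. \<Sum>k\<in>J. w j * w k *
      (excess b (q j) (s j) (q k) (s k) - 2 * \<beta> ^ 3 / (b - 1) * min (s j) (s k))) \<le> 0"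
proof -
  define c where "c = 2 * \<beta> ^ 3 / (b - 1)"
  have b: "b > 1" using \<beta> by (simp add: b_def)
  have c: "c \<ge> 0" using b \<beta> by (simp add: c_def)
  define K where "K q s j k = excess b (q j) (s j) (q k) (s k) - c * min (s j) (s k)"
    for q s and j k :: 'a
  \<comment> \<open>\<open>A\<close> contains the jobs that may still be unaligned. The rounds are
    generalized together with the ratios, since a job pushed to its upper end is reassigned to the
    next round; closed intervals allow both assignments of a common endpoint.\<close>
  have "(\<Sum>j\<in>J. \<Sum>k\<in>J. w j * w k * K q s j k) \<le> 0"
    if "finite A" "A \<subseteq> J" "\<And>j. j \<in> J \<Longrightarrow> b powi (q j - 1) \<le> s j \<and> s j \<le> b powi q j"
      "\<And>j. j \<in> J - A \<Longrightarrow> s j = b powi (q j - 1)" for A q s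
    using that
  proof (induction A arbitrary: q s rule: finite_induct)
    case empty
    have "(\<Sum>j\<in>J. \<Sum>k\<in>J. w j * w k * K q s j k) = (\<Sum>j\<in>J. \<Sum>k\<in>J. w j * w k * K q (\<lambda>j. b powi (q j - 1)) j k)"
      using empty.prems(3) by (intro sum.cong refl) (simp add: K_def)
    then show ?case
      using aligned_gap_sum_nonpos[OF J \<beta>, of w q] by (simp add: K_def c_def b_def)
  next
    case (insert i A)
    then have i: "i \<in> J" by simp
    define X where "X = b powi (q i - 1)"
    define Y where "Y = b powi q i"
    have XY: "X < Y" using b by (auto simp: X_def Y_def intro: power_int_strict_increasing)
    have si: "X \<le> s i" "s i \<le> Y" using insert.prems(2)[OF i] by (simp_all add: X_def Y_def)
    define l where "l = (s i - X) / (Y - X)"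
    have l: "0 \<le> l" "l \<le> 1" using XY si by (simp_all add: l_def)
    have "l * (Y - X) = s i - X" using XY by (simp add: l_def)
    then have s_eq: "s i = (1 - l) * b powi (q i - 1) + l * b powi q i"
      by (simp add: X_def[symmetric] Y_def[symmetric] algebra_simps)
    define s0 where "s0 = s(i := X)"
    define s1 where "s1 = s(i := Y)"
    define q1 where "q1 = q(i := q i + 1)"
    have "b powi q i \<le> b powi (q i + 1)" using b by (intro powi_mono_base_gt_1) auto
    then have 1: "(\<Sum>j\<in>J. \<Sum>k\<in>J. w j * w k * K q1 s1 j k) \<le> 0"
      using insert.prems by (intro insert.IH) (auto simp: s1_def q1_def Y_def)
    have 0: "(\<Sum>j\<in>J. \<Sum>k\<in>J. w j * w k * K q s0 j k) \<le> 0"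
      using insert.prems XY by (intro insert.IH) (auto simp: s0_def X_def Y_def)
    have row: "K q s i k \<le> (1 - l) * K q s0 i k + l * K q1 s1 i k" if "k \<in> J" "k \<noteq> i" for k
      using gap_kernel_le[OF b c l s_eq, of "q k" "s k"] insert.prems(2)[OF that(1)] that(2)
      by (simp add: K_def s0_def s1_def q1_def X_def Y_def)
    have K_commute: "K q s j k = K q s k j" for q s j k
      by (simp add: K_def excess_commute min.commute)
    have K_le: "K q s j k \<le> (1 - l) * K q s0 j k + l * K q1 s1 j k" if "j \<in> J" "k \<in> J" for j k
    proof -
      consider "j = i" "k = i" | "j = i" "k \<noteq> i" | "j \<noteq> i" "k = i" | "j \<noteq> i" "k \<noteq> i" by blast
      then show ?thesis
      proof cases
        case 1
        then show ?thesis
          using gap_kernel_diag_le[OF b l s_eq, of c]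
          by (simp add: K_def s0_def s1_def q1_def X_def Y_def)
      next
        case 3
        then show ?thesis using row[OF that(1)] by (simp add: K_commute[of _ _ j])
      next
        case 4
        then show ?thesis by (simp add: K_def s0_def s1_def q1_def algebra_simps)
      qed (use row that in simp)
    qed
    have "(\<Sum>j\<in>J. \<Sum>k\<in>J. w j * w k * K q s j k)
        \<le> (\<Sum>j\<in>J. \<Sum>k\<in>J. w j * w k * ((1 - l) * K q s0 j k + l * K q1 s1 j k))"
      using w by (intro sum_mono mult_left_mono K_le) auto
    also have "\<dots> = (1 - l) * (\<Sum>j\<in>J. \<Sum>k\<in>J. w j * w k * K q s0 j k)
        + l * (\<Sum>j\<in>J. \<Sum>k\<in>J. w j * w k * K q1 s1 j k)"
      unfolding sum_distrib_left sum.distrib[symmetric]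
      by (intro sum.cong refl) (simp only: distrib_left mult.left_commute)
    also have "\<dots> \<le> 0"
      using 0 1 l by (intro add_nonpos_nonpos mult_nonneg_nonpos) auto
    finally show ?case .
  qed
  from this[OF J order_refl s] show ?thesis
    by (simp add: K_def c_def)
qed

section \<open>A lower bound on the optimum\<close>

text \<open>Induction by removing the job \<open>j\<close> that finishes last. A job running after
  \<open>j\<close> would finish later still, so all others end by \<open>S j\<close>, which becomes
  the new \<open>T\<close>.\<close>

lemma sum_ptime_le_of_disjoint:
  assumes I: "valid_instance I" and S: "feasible_schedule I S"
    and "finite A" "A \<subseteq> {..<num_jobs I}" "0 \<le> T" "\<And>k. k \<in> A \<Longrightarrow> S k + ptime I k \<le> T"
  shows "sum (ptime I) A \<le> T"
  using assms(3-)
proof (induction "card A" arbitrary: A T)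
  case 0
  then show ?case by simp
next
  case (Suc m)
  then have "A \<noteq> {}" by auto
  define C where "C k = S k + ptime I k" for k
  obtain j where j: "j \<in> A" "\<And>k. k \<in> A \<Longrightarrow> C k \<le> C j"
  proof -
    have "Max (C ` A) \<in> C ` A" using \<open>A \<noteq> {}\<close> Suc.prems(1) by simp
    then obtain j where "j \<in> A" "C j = Max (C ` A)" by auto
    with Suc.prems(1) that show thesis by auto
  qed
  have "sum (ptime I) (A - {j}) \<le> S j"
  proof (rule Suc.hyps(1))
    show "m = card (A - {j})" using Suc.hyps(2) Suc.prems(1) j(1) by simp
    show "0 \<le> S j" using S j(1) Suc.prems(2) by (auto simp: feasible_schedule_def)
    fix k assume k: "k \<in> A - {j}"
    have "ptime I k > 0" using I k Suc.prems(2) by (auto simp: valid_instance_def)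
    moreover have "S j + ptime I j \<le> S k \<or> S k + ptime I k \<le> S j"
      using S k j(1) Suc.prems(2) unfolding feasible_schedule_def by blast
    ultimately show "S k + ptime I k \<le> S j"
      using j(2)[of k] k by (auto simp: C_def)
  qed (use Suc.prems in auto)
  moreover have "sum (ptime I) A = ptime I j + sum (ptime I) (A - {j})"
    using Suc.prems(1) j(1) by (simp add: sum.remove)
  ultimately show ?case using Suc.prems(4)[OF j(1)] by simp
qed

definition smith_ratio :: "job_instance \<Rightarrow> nat \<Rightarrow> real" where
  "smith_ratio I j = ptime I j / weight I j"

lemma sum_sum_symmetrize:
  fixes f :: "'a \<Rightarrow> 'a \<Rightarrow> real"
  shows "2 * (\<Sum>j\<in>A. \<Sum>k\<in>A. f j k) = (\<Sum>j\<in>A. \<Sum>k\<in>A. f j k + f k j)"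
proof -
  have "(\<Sum>j\<in>A. \<Sum>k\<in>A. f j k + f k j) = (\<Sum>j\<in>A. \<Sum>k\<in>A. f j k) + (\<Sum>j\<in>A. \<Sum>k\<in>A. f k j)"
    by (simp add: sum.distrib)
  also have "(\<Sum>j\<in>A. \<Sum>k\<in>A. f k j) = (\<Sum>j\<in>A. \<Sum>k\<in>A. f j k)"
    by (rule sum.swap)
  finally show ?thesis by simp
qed

text \<open>For positive weights, a summand is the smaller of \<open>weight I k * ptime I j\<close>
  and \<open>weight I j * ptime I k\<close>, the cheaper way to order the pair. Pairs occur twice
  and the diagonal once, so adding the diagonal again gives twice the cost of the order by
  nondecreasing \<open>smith_ratio\<close>.\<close>

definition min_ratio_sum :: "job_instance \<Rightarrow> real" where
  "min_ratio_sum I = (\<Sum>j<num_jobs I. \<Sum>k<num_jobs I.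
     weight I j * weight I k * min (smith_ratio I j) (smith_ratio I k))"

text \<open>Job \<open>j\<close> is charged \<open>f j k\<close> for every \<open>k\<close> that
  finishes no later, itself included. For each pair at least one of \<open>f j k\<close> and
  \<open>f k j\<close> is incurred, and either is at least the minimum.\<close>

lemma feasible_objective_ge:
  assumes I: "valid_instance I" and S: "feasible_schedule I S"
  shows "min_ratio_sum I + (\<Sum>j<num_jobs I. weight I j * ptime I j)
    \<le> 2 * objective I (\<lambda>j. S j + ptime I j)"
proof -
  let ?J = "{..<num_jobs I}"
  define C where "C k = S k + ptime I k" for k
  define f where "f j k = (if C k \<le> C j then weight I j * ptime I k else 0)" for j k
  have pos: "ptime I j > 0" "weight I j > 0" if "j \<in> ?J" for j
    using I that by (auto simp: valid_instance_def)
  have "(\<Sum>j\<in>?J. \<Sum>k\<in>?J. f j k) \<le> objective I C"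
    unfolding objective_def
  proof (intro sum_mono)
    fix j assume j: "j \<in> ?J"
    have "(\<Sum>k\<in>?J. f j k) = weight I j * sum (ptime I) {k\<in>?J. C k \<le> C j}"
      unfolding f_def sum_distrib_left by (rule sum.inter_filter[symmetric]) simp
    also have "sum (ptime I) {k\<in>?J. C k \<le> C j} \<le> C j"
    proof (rule sum_ptime_le_of_disjoint[OF I S])
      show "0 \<le> C j" using S j pos[OF j] by (auto simp: feasible_schedule_def C_def)
    qed (auto simp: C_def)
    finally show "(\<Sum>k\<in>?J. f j k) \<le> weight I j * C j" using pos[OF j] by simp
  qed
  then have "(\<Sum>j\<in>?J. \<Sum>k\<in>?J. f j k + f k j) \<le> 2 * objective I C"
    by (simp flip: sum_sum_symmetrize)
  moreover have "(\<Sum>k\<in>?J. weight I j * weight I k * min (smith_ratio I j) (smith_ratio I k))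
      + weight I j * ptime I j \<le> (\<Sum>k\<in>?J. f j k + f k j)" if j: "j \<in> ?J" for j
  proof -
    have eq: "weight I j * weight I k * min (smith_ratio I j) (smith_ratio I k)
        = min (weight I k * ptime I j) (weight I j * ptime I k)" if k: "k \<in> ?J" for k
    proof -
      have "weight I j * weight I k * min (smith_ratio I j) (smith_ratio I k)
        = min (weight I j * weight I k * smith_ratio I j) (weight I j * weight I k * smith_ratio I k)"
        using pos[OF j] pos[OF k] by (simp add: min_mult_distrib_left)
      then show ?thesis using pos[OF j] pos[OF k] by (simp add: smith_ratio_def)
    qed
    \<comment> \<open>The diagonal charge \<open>f j j\<close> is counted twice: once for the
      minimum and once for the extra \<open>weight I j * ptime I j\<close>.\<close>
    have "(\<Sum>k\<in>?J. weight I j * weight I k * min (smith_ratio I j) (smith_ratio I k))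
        + weight I j * ptime I j
      = (\<Sum>k\<in>?J. weight I j * weight I k * min (smith_ratio I j) (smith_ratio I k)
          + (if k = j then weight I j * ptime I j else 0))"
      using j by (simp add: sum.distrib)
    also have "\<dots> \<le> (\<Sum>k\<in>?J. f j k + f k j)"
    proof (rule sum_mono)
      fix k assume k: "k \<in> ?J"
      show "weight I j * weight I k * min (smith_ratio I j) (smith_ratio I k)
          + (if k = j then weight I j * ptime I j else 0) \<le> f j k + f k j"
        unfolding eq[OF k] using pos[OF j] pos[OF k] by (auto simp: f_def min_def)
    qed
    finally show ?thesis .
  qed
  then have "min_ratio_sum I + (\<Sum>j\<in>?J. weight I j * ptime I j)
      \<le> (\<Sum>j\<in>?J. \<Sum>k\<in>?J. f j k + f k j)"
    unfolding min_ratio_sum_def sum.distrib[symmetric] by (intro sum_mono) auto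
  ultimately show ?thesis by (simp add: C_def[abs_def])
qed

text \<open>Processing in index order without idling shows that the infimum in \<open>OPT\<close> is
  over a nonempty set.\<close>

lemma feasible_schedule_exists:
  assumes "valid_instance I"
  shows "feasible_schedule I (\<lambda>j. sum (ptime I) {..<j})"
proof -
  have *: "sum (ptime I) {..<j} + ptime I j \<le> sum (ptime I) {..<k}"
    if "j < k" "k < num_jobs I" for j k
  proof -
    have "sum (ptime I) {..<Suc j} \<le> sum (ptime I) {..<k}"
      using that assms by (intro sum_mono2) (auto simp: valid_instance_def less_imp_le)
    then show ?thesis by simp
  qed
  show ?thesis
    unfolding feasible_schedule_def
  proof (intro conjI allI impI)
    fix j assume "j < num_jobs I"
    then show "0 \<le> sum (ptime I) {..<j}"
      using assms by (intro sum_nonneg) (auto simp: valid_instance_def less_imp_le)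
  next
    fix j k assume "j < num_jobs I" "k < num_jobs I" "j \<noteq> k"
    then show "sum (ptime I) {..<j} + ptime I j \<le> sum (ptime I) {..<k} \<or>
      sum (ptime I) {..<k} + ptime I k \<le> sum (ptime I) {..<j}"
      using * by (metis linorder_neqE_nat)
  qed
qed

lemma OPT_ge:
  assumes "valid_instance I"
  shows "min_ratio_sum I + (\<Sum>j<num_jobs I. weight I j * ptime I j) \<le> 2 * OPT I"
proof -
  have "(min_ratio_sum I + (\<Sum>j<num_jobs I. weight I j * ptime I j)) / 2 \<le> OPT I"
    unfolding OPT_def
  proof (rule cINF_greatest)
    show "{S. feasible_schedule I S} \<noteq> {}"
      using feasible_schedule_exists[OF assms] by auto
  qed (use feasible_objective_ge[OF assms] in force)
  then show ?thesis by simp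
qed

section \<open>The schedule of the scaling strategy\<close>

definition completion_round :: "real \<Rightarrow> job_instance \<Rightarrow> nat \<Rightarrow> int" where
  "completion_round b I j = \<lceil>log b (smith_ratio I j)\<rceil>"

lemma completion_round_bounds:
  assumes b: "b > 1" and "0 < smith_ratio I j"
  shows "b powi (completion_round b I j - 1) < smith_ratio I j"
    and "smith_ratio I j \<le> b powi completion_round b I j"
proof -
  let ?l = "log b (smith_ratio I j)"
  have s: "smith_ratio I j = b powr ?l" using assms by simp
  have p: "b powr real_of_int n = b powi n" for n
    using b by (simp add: powr_real_of_int')
  have "b powr real_of_int (\<lceil>?l\<rceil> - 1) < b powr ?l"
    using b by (intro powr_less_mono) linarith+
  then show "b powi (completion_round b I j - 1) < smith_ratio I j"
    by (simp only: completion_round_def p s[symmetric])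
  have "b powr ?l \<le> b powr real_of_int \<lceil>?l\<rceil>"
    using b by (intro powr_mono) linarith+
  then show "smith_ratio I j \<le> b powi completion_round b I j"
    by (simp only: completion_round_def p s[symmetric])
qed

lemma ptime_le_probe_iff:
  assumes b: "b > 1" and "valid_instance I" "j < num_jobs I"
  shows "ptime I j \<le> weight I j * b powi q \<longleftrightarrow> completion_round b I j \<le> q"
proof -
  have pos: "ptime I j > 0" "weight I j > 0" using assms by (auto simp: valid_instance_def)
  then have s: "smith_ratio I j > 0" by (simp add: smith_ratio_def)
  note cr = completion_round_bounds[OF b s]
  have "ptime I j \<le> weight I j * b powi q \<longleftrightarrow> smith_ratio I j \<le> b powi q"
    using pos by (simp add: smith_ratio_def field_simps)
  also have "\<dots> \<longleftrightarrow> completion_round b I j \<le> q"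
  proof
    assume "smith_ratio I j \<le> b powi q"
    then have "b powi (completion_round b I j - 1) < b powi q" using cr by linarith
    then show "completion_round b I j \<le> q"
      using b power_int_increasing[of q "completion_round b I j - 1" b] by force
  next
    assume "completion_round b I j \<le> q"
    then have "b powi completion_round b I j \<le> b powi q"
      using b by (intro power_int_increasing) auto
    then show "smith_ratio I j \<le> b powi q" using cr by linarith
  qed
  finally show ?thesis .
qed

text \<open>Time spent on job \<open>k\<close> before round \<open>q\<close>. The parameter \<open>x\<close> stands for \<open>b powi q\<^sub>0\<close>; the limit
  strategy has \<open>x = 0\<close>.\<close>

definition probing_time :: "real \<Rightarrow> job_instance \<Rightarrow> real \<Rightarrow> nat \<Rightarrow> int \<Rightarrow> real" where
  "probing_time b I x k q =
     weight I k * (b powi min q (completion_round b I k) - x) / (b - 1)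
       + (if completion_round b I k < q then ptime I k else 0)"

text \<open>The time when the first \<open>l\<close> jobs have been handled in round \<open>q\<close>.\<close>

definition elapsed_time :: "real \<Rightarrow> job_instance \<Rightarrow> real \<Rightarrow> int \<Rightarrow> nat \<Rightarrow> real" where
  "elapsed_time b I x q l =
     (\<Sum>k<num_jobs I. probing_time b I x k (if k < l then q + 1 else q))"

text \<open>The closed geometric sum grows by \<open>weight I k * b powi q\<close> per aborted
  round. The \<open>min\<close> freezes it from the completion round on, where
  \<open>ptime I k\<close> is added instead.\<close>

lemma probing_time_Suc_round:
  assumes "b > 1"
  shows "probing_time b I x k (q + 1) = probing_time b I x k q +
     (if q < completion_round b I k then weight I k * b powi q
      else if q = completion_round b I k then ptime I k else 0)"
proof -
  have "b powi (q + 1) = b * b powi q" using assms by (simp add: power_int_add)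
  then have "weight I k * (b powi (q + 1) - x) / (b - 1)
      = weight I k * (b powi q - x) / (b - 1) + weight I k * b powi q"
    using assms by (simp add: field_simps)
  then show ?thesis by (auto simp: probing_time_def min_def)
qed

lemma elapsed_time_Suc:
  assumes "l < num_jobs I"
  shows "elapsed_time b I x q (Suc l) =
     elapsed_time b I x q l + (probing_time b I x l (q + 1) - probing_time b I x l q)"
proof -
  have "elapsed_time b I x q (Suc l) = (\<Sum>k<num_jobs I. probing_time b I x k (if k < l then q + 1 else q)
      + (if k = l then probing_time b I x l (q + 1) - probing_time b I x l q else 0))"
    unfolding elapsed_time_def by (intro sum.cong) auto
  then show ?thesis using assms by (simp add: sum.distrib elapsed_time_def)
qed

text \<open>The argument \<open>Suc j\<close> reads the clock just after \<open>j\<close> itself has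
  been handled in its last round.\<close>

definition finish_time :: "real \<Rightarrow> job_instance \<Rightarrow> real \<Rightarrow> nat \<Rightarrow> real" where
  "finish_time b I x j = elapsed_time b I x (completion_round b I j) (Suc j)"

text \<open>Invariant inside a round: jobs below \<open>l\<close> are described as if round
  \<open>q + 1\<close> had begun. For \<open>l = num_jobs I\<close> this is the initial state of the
  next round.\<close>

lemma fold_probe_round:
  assumes b: "b > 1" and I: "valid_instance I" and "l \<le> num_jobs I"
    and st: "st = (elapsed_time b I x q 0,
        \<lambda>j. if j < num_jobs I \<and> completion_round b I j < q then Some (finish_time b I x j) else None)"
  shows "fold (probe I) (map (\<lambda>j. (j, weight I j * b powi q)) [0..<l]) st =
    (elapsed_time b I x q l,
     \<lambda>j. if j < num_jobs I \<and> completion_round b I j < (if j < l then q + 1 else q)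
         then Some (finish_time b I x j) else None)"
  using assms(3)
proof (induction l)
  case 0
  then show ?case by (simp add: st)
next
  case (Suc l)
  then have l: "l < num_jobs I" by simp
  \<comment> \<open>These are the three branches of \<open>probe\<close>: the request is skipped,
    completes the job, or is aborted.\<close>
  consider "completion_round b I l < q" | "completion_round b I l = q" | "q < completion_round b I l"
    by linarith
  then show ?case
  proof cases
    case 1
    then show ?thesis
      using Suc.IH l probing_time_Suc_round[OF b, of I x l q]
      by (auto simp: probe_def elapsed_time_Suc fun_eq_iff less_Suc_eq)
  next
    case 2
    then have "finish_time b I x l = elapsed_time b I x q l + ptime I l"
      using l probing_time_Suc_round[OF b, of I x l q]
      by (simp add: finish_time_def elapsed_time_Suc)
    then show ?thesis
      using Suc.IH l 2 probing_time_Suc_round[OF b, of I x l q] ptime_le_probe_iff[OF b I l, of q]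
      by (auto simp: probe_def elapsed_time_Suc fun_eq_iff less_Suc_eq)
  next
    case 3
    then show ?thesis
      using Suc.IH l probing_time_Suc_round[OF b, of I x l q] ptime_le_probe_iff[OF b I l, of q]
      by (auto simp: probe_def elapsed_time_Suc fun_eq_iff less_Suc_eq)
  qed
qed

lemma elapsed_time_next_round: "elapsed_time b I x q (num_jobs I) = elapsed_time b I x (q + 1) 0"
  by (simp add: elapsed_time_def)

lemma scaling_run_eq:
  assumes b: "b > 1" and I: "valid_instance I"
    and q0: "\<And>j. j < num_jobs I \<Longrightarrow> q\<^sub>0 \<le> completion_round b I j"
  shows "scaling_run b I q\<^sub>0 m = (elapsed_time b I (b powi q\<^sub>0) (q\<^sub>0 + int m) 0,
     \<lambda>j. if j < num_jobs I \<and> completion_round b I j < q\<^sub>0 + int m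
         then Some (finish_time b I (b powi q\<^sub>0) j) else None)"
proof (induction m)
  case 0
  \<comment> \<open>No completion round precedes \<open>q\<^sub>0\<close>, so every
    \<open>min\<close> equals \<open>q\<^sub>0\<close> and its power cancels against
    \<open>x = b powi q\<^sub>0\<close>.\<close>
  have "elapsed_time b I (b powi q\<^sub>0) q\<^sub>0 0 = 0"
    using q0 by (force simp: elapsed_time_def probing_time_def min_def intro!: sum.neutral)
  then show ?case using q0 by (force simp: fun_eq_iff)
next
  case (Suc m)
  show ?case
    unfolding scaling_run.simps scaling_round_def fold_probe_round[OF b I order_refl Suc.IH]
    by (auto simp: elapsed_time_next_round fun_eq_iff algebra_simps)
qed

lemma truncated_completion_eq:
  assumes "b > 1" "valid_instance I" "j < num_jobs I"
    and q0: "\<And>j. j < num_jobs I \<Longrightarrow> q\<^sub>0 \<le> completion_round b I j"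
  shows "truncated_completion b I q\<^sub>0 j = finish_time b I (b powi q\<^sub>0) j"
  unfolding truncated_completion_def
proof (rule the_equality)
  \<comment> \<open>The number of rounds up to and including the one that completes
    \<open>j\<close>.\<close>
  let ?m = "nat (completion_round b I j + 1 - q\<^sub>0)"
  show "\<exists>m. snd (scaling_run b I q\<^sub>0 m) j = Some (finish_time b I (b powi q\<^sub>0) j)"
    using assms(3) q0[OF assms(3)]
    by (intro exI[of _ ?m]) (simp add: scaling_run_eq[OF assms(1,2) q0])
qed (auto simp: scaling_run_eq[OF assms(1,2) q0] split: if_splits)

lemma tendsto_powi_at_bot:
  fixes b :: real
  assumes "b > 1"
  shows "((\<lambda>q. b powi q) \<longlongrightarrow> 0) at_bot"
proof -
  have "filterlim real_of_int at_bot at_bot"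
    unfolding filterlim_at_bot eventually_at_bot_linorder
  proof
    fix C :: real
    show "\<exists>N. \<forall>n\<le>N. real_of_int n \<le> C"
      by (intro exI[of _ "\<lfloor>C\<rfloor>"]) linarith
  qed
  then have "filterlim (\<lambda>q. ln b * real_of_int q) at_bot at_bot"
    using assms by (intro filterlim_tendsto_pos_mult_at_bot[OF tendsto_const]) auto
  then have "((\<lambda>q. exp (ln b * real_of_int q)) \<longlongrightarrow> 0) at_bot"
    by (rule filterlim_compose[OF exp_at_bot])
  moreover have "exp (ln b * real_of_int q) = b powi q" for q
    using assms powr_real_of_int'[of b q] by (simp add: powr_def mult.commute)
  ultimately show ?thesis by simp
qed

text \<open>For all start rounds up to the earliest completion round the closed form applies. It is
  affine in \<open>x = b powi q\<^sub>0\<close>, which tends to \<open>0\<close>.\<close>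

lemma scaling_completion_eq:
  assumes "b > 1" "valid_instance I" "j < num_jobs I"
  shows "scaling_completion b I j = finish_time b I 0 j"
proof -
  define m where "m = Min (completion_round b I ` {..<num_jobs I})"
  have "eventually (\<lambda>q\<^sub>0. q\<^sub>0 \<le> m) at_bot" by (rule eventually_le_at_bot)
  then have ev: "eventually (\<lambda>q\<^sub>0. finish_time b I (b powi q\<^sub>0) j = truncated_completion b I q\<^sub>0 j) at_bot"
  proof eventually_elim
    case (elim q)
    have "q \<le> completion_round b I k" if "k < num_jobs I" for k
    proof -
      have "m \<le> completion_round b I k" unfolding m_def by (rule Min_le) (use that in auto)
      with elim show ?thesis by simp
    qed
    then show ?case using truncated_completion_eq[OF assms] by simp
  qed
  have "((\<lambda>q\<^sub>0. finish_time b I (b powi q\<^sub>0) j) \<longlongrightarrow> finish_time b I 0 j) at_bot"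
    unfolding finish_time_def elapsed_time_def probing_time_def
    by (intro tendsto_intros tendsto_powi_at_bot assms) (use assms in auto)
  then have "((\<lambda>q\<^sub>0. truncated_completion b I q\<^sub>0 j) \<longlongrightarrow> finish_time b I 0 j) at_bot"
    using ev by (rule Lim_transform_eventually)
  then show ?thesis
    unfolding scaling_completion_def by (intro tendsto_Lim) auto
qed

section \<open>The competitive ratio\<close>

text \<open>As \<open>k\<close> precedes \<open>j\<close> in every round, \<open>j\<close> also
  waits for the probing of \<open>k\<close> in round \<open>q j\<close>, whereas \<open>k\<close>
  waits for \<open>j\<close> only in rounds before \<open>q k\<close>. This explains the asymmetric
  arguments \<open>q j + 1\<close> and \<open>q k\<close>.\<close>

lemma pair_probing_le:
  assumes b: "b > 1" and pos: "weight I j > 0" "weight I k > 0" and kj: "k < j"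
  defines "q \<equiv> completion_round b I" and "s \<equiv> smith_ratio I"
  assumes s: "s j > 0" "s k > 0"
  shows "weight I j * probing_time b I 0 k (q j + 1) + weight I k * probing_time b I 0 j (q k)
    \<le> weight I j * weight I k * (min (s j) (s k) + excess b (q j) (s j) (q k) (s k))"
proof -
  have p: "ptime I j = weight I j * s j" "ptime I k = weight I k * s k"
    using pos by (simp_all add: s_def smith_ratio_def)
  have bounds: "b powi (q i - 1) < s i" "s i \<le> b powi q i" if "s i > 0" for i
    using completion_round_bounds[OF b] that by (simp_all add: q_def s_def)
  define m where "m = min (q j) (q k)"
  define \<delta> where "\<delta> = weight I j * weight I k"
  have \<delta>: "\<delta> > 0" using pos by (simp add: \<delta>_def)
  define B where "B = b powi m / (b - 1)"
  have B: "2 * b powi m / (b - 1) = 2 * B" by (simp add: B_def)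
  have e: "excess b (q j) (s j) (q k) (s k) = 2 * B + b powi m" if "q j \<noteq> q k"
    using that B by (simp add: excess_def m_def)
  consider "q k < q j" | "q k = q j" | "q j < q k" by linarith
  then show ?thesis
  proof cases
    case 1
    then have m: "m = q k" "q j \<noteq> q k" by (auto simp: m_def)
    have "s k \<le> s j"
      using bounds[OF s(1)] bounds[OF s(2)] 1 powi_mono_base_gt_1[OF b, of "q k" "q j - 1"] by simp
    then have "weight I j * weight I k * (min (s j) (s k) + excess b (q j) (s j) (q k) (s k))
        = \<delta> * (s k + 2 * B + b powi m)"
      using e[OF m(2)] by (simp add: \<delta>_def)
    moreover have "weight I j * probing_time b I 0 k (q j + 1) = \<delta> * (B + s k)"
      using 1 m by (simp add: probing_time_def q_def[symmetric] p B_def \<delta>_def algebra_simps)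
    moreover have "weight I k * probing_time b I 0 j (q k) = \<delta> * B"
      using 1 m by (simp add: probing_time_def q_def[symmetric] p B_def \<delta>_def algebra_simps)
    \<comment> \<open>Slack: the extra probing in the excess does not occur, because the job that
      completes later is also the later one in the order.\<close>
    moreover have "\<delta> * b powi m \<ge> 0" using \<delta> b by simp
    ultimately show ?thesis by (simp add: algebra_simps)
  next
    case 2
    then have m: "m = q k" "m = q j" by (auto simp: m_def)
    have "weight I j * weight I k * (min (s j) (s k) + excess b (q j) (s j) (q k) (s k))
        = \<delta> * (min (s j) (s k) + 2 * B + \<bar>s j - s k\<bar>)"
      using 2 B[unfolded m(2)] by (simp add: excess_def \<delta>_def)
    moreover have "weight I j * probing_time b I 0 k (q j + 1) = \<delta> * (B + s k)"
      using m by (simp add: probing_time_def q_def[symmetric] p B_def \<delta>_def algebra_simps)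
    moreover have "weight I k * probing_time b I 0 j (q k) = \<delta> * B"
      using m by (simp add: probing_time_def q_def[symmetric] p B_def \<delta>_def algebra_simps)
    moreover have "\<delta> * s k \<le> \<delta> * (min (s j) (s k) + \<bar>s j - s k\<bar>)"
      using \<delta> by (intro mult_left_mono) auto
    ultimately show ?thesis by (simp add: algebra_simps)
  next
    case 3
    then have m: "m = q j" "q j \<noteq> q k" by (auto simp: m_def)
    have "s j \<le> s k"
      using bounds[OF s(1)] bounds[OF s(2)] 3 powi_mono_base_gt_1[OF b, of "q j" "q k - 1"] by simp
    then have "weight I j * weight I k * (min (s j) (s k) + excess b (q j) (s j) (q k) (s k))
        = \<delta> * (s j + 2 * B + b powi m)"
      using e[OF m(2)] by (simp add: \<delta>_def)
    \<comment> \<open>Job \<open>k\<close> is probed in vain once more in round \<open>q j\<close>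
      before \<open>j\<close> completes, so here the excess is attained.\<close>
    moreover have "b powi (q j + 1) / (b - 1) = B + b powi m"
      using b m by (simp add: B_def power_int_add field_simps)
    then have "probing_time b I 0 k (q j + 1) = weight I k * (B + b powi m)"
      using 3 by (simp add: probing_time_def q_def[symmetric] times_divide_eq_right[symmetric]
          del: times_divide_eq_right)
    then have "weight I j * probing_time b I 0 k (q j + 1) = \<delta> * (B + b powi m)"
      by (simp add: \<delta>_def)
    moreover have "weight I k * probing_time b I 0 j (q k) = \<delta> * (B + s j)"
      using 3 m by (simp add: probing_time_def q_def[symmetric] p B_def \<delta>_def algebra_simps)
    ultimately show ?thesis by (simp add: algebra_simps)
  qed
qed

lemma scaling_strategy_le:
  assumes b: "b > 1" and I: "valid_instance I"
  defines "q \<equiv> completion_round b I" and "s \<equiv> smith_ratio I"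
  shows "2 * scaling_strategy b I \<le> min_ratio_sum I + (\<Sum>j<num_jobs I. weight I j * ptime I j)
    + (\<Sum>j<num_jobs I. \<Sum>k<num_jobs I. weight I j * weight I k * excess b (q j) (s j) (q k) (s k))"
proof -
  let ?J = "{..<num_jobs I}"
  let ?E = "\<lambda>j k. weight I j * weight I k * excess b (q j) (s j) (q k) (s k)"
  let ?M = "\<lambda>j k. weight I j * weight I k * min (s j) (s k)"
  have pos: "ptime I j > 0" "weight I j > 0" "s j > 0" if "j \<in> ?J" for j
    using I that by (auto simp: valid_instance_def s_def smith_ratio_def)
  define f where "f j k = weight I j * probing_time b I 0 k (if k < Suc j then q j + 1 else q j)" for j k
  have "scaling_strategy b I = (\<Sum>j\<in>?J. \<Sum>k\<in>?J. f j k)"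
    unfolding scaling_strategy_def objective_def f_def q_def
    by (intro sum.cong refl)
      (simp add: scaling_completion_eq[OF b I] finish_time_def elapsed_time_def sum_distrib_left)
  then have "2 * scaling_strategy b I = (\<Sum>j\<in>?J. \<Sum>k\<in>?J. f j k + f k j)"
    by (simp add: sum_sum_symmetrize)
  also have "\<dots> \<le> (\<Sum>j\<in>?J. \<Sum>k\<in>?J. ?M j k + ?E j k + (if k = j then weight I j * ptime I j else 0))"
  proof (intro sum_mono)
    fix j k assume jk: "j \<in> ?J" "k \<in> ?J"
    note p = pos[OF jk(1)] pos[OF jk(2)]
    consider "k < j" | "k = j" | "j < k" by linarith
    then show "f j k + f k j \<le> ?M j k + ?E j k + (if k = j then weight I j * ptime I j else 0)"
    proof cases
      case 1
      then show ?thesis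
        using pair_probing_le[OF b p(2) p(5) 1] p by (simp add: f_def q_def s_def distrib_left)
    next
      case 2
      \<comment> \<open>Equality holds on the diagonal: the wasted probings of \<open>j\<close>,
        counted twice, form its excess, and the two copies of \<open>weight I j * ptime I j\<close>
        are the minimum and the extra term.\<close>
      have "ptime I j = weight I j * s j" using p by (simp add: s_def smith_ratio_def)
      then show ?thesis
        using 2 by (simp add: f_def probing_time_def excess_def q_def[symmetric] algebra_simps)
    next
      case 3
      then show ?thesis
        using pair_probing_le[OF b p(5) p(2) 3] p
        by (simp add: f_def q_def s_def distrib_left min.commute excess_commute mult.commute)
    qed
  qed
  also have "\<dots> = min_ratio_sum I + (\<Sum>j\<in>?J. weight I j * ptime I j) + (\<Sum>j\<in>?J. \<Sum>k\<in>?J. ?E j k)"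
    by (simp add: sum.distrib min_ratio_sum_def s_def)
  finally show ?thesis .
qed

lemma scaling_bound_eq:
  assumes "b > 1"
  shows "scaling_bound b = 1 + 2 * sqrt b ^ 3 / (b - 1)"
proof -
  have "sqrt b ^ 3 = (b powr (1/2)) powr real 3"
    using assms by (simp add: powr_half_sqrt powr_realpow)
  also have "\<dots> = b powr (3/2)" by (simp add: powr_powr)
  finally show ?thesis by (simp add: scaling_bound_def)
qed

lemma scaling_strategy_competitive:
  assumes b: "b > 1"
  shows "competitive (scaling_bound b) (scaling_strategy b)"
  unfolding competitive_def
proof (intro allI impI)
  fix I assume I: "valid_instance I"
  let ?J = "{..<num_jobs I}"
  let ?q = "completion_round b I" and ?s = "smith_ratio I"
  define c where "c = 2 * sqrt b ^ 3 / (b - 1)"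
  define V where "V = (\<Sum>j\<in>?J. weight I j * ptime I j)"
  define X where "X = (\<Sum>j\<in>?J. \<Sum>k\<in>?J. weight I j * weight I k * excess b (?q j) (?s j) (?q k) (?s k))"
  have c: "c \<ge> 0" using b by (simp add: c_def)
  have pos: "weight I j > 0" "ptime I j > 0" "?s j > 0" if "j \<in> ?J" for j
    using I that by (auto simp: valid_instance_def smith_ratio_def)
  have V: "V \<ge> 0" unfolding V_def using pos by (intro sum_nonneg) (auto simp: less_imp_le)
  have "(\<Sum>j\<in>?J. \<Sum>k\<in>?J. weight I j * weight I k *
      (excess b (?q j) (?s j) (?q k) (?s k) - c * min (?s j) (?s k))) \<le> 0"
    using gap_sum_nonpos[of ?J "sqrt b" "weight I" ?q ?s] b pos completion_round_bounds[OF b]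
    by (simp add: c_def less_imp_le)
  also have "(\<Sum>j\<in>?J. \<Sum>k\<in>?J. weight I j * weight I k *
      (excess b (?q j) (?s j) (?q k) (?s k) - c * min (?s j) (?s k))) = X - c * min_ratio_sum I"
    unfolding X_def min_ratio_sum_def sum_distrib_left sum_subtractf[symmetric]
    by (intro sum.cong refl) (simp add: algebra_simps)
  finally have "X \<le> c * min_ratio_sum I" by simp
  moreover have "c * (min_ratio_sum I + V) \<le> c * (2 * OPT I)"
    using OPT_ge[OF I] c by (intro mult_left_mono) (simp_all add: V_def)
  \<comment> \<open>This slack raises \<open>min_ratio_sum I + V + c * min_ratio_sum I\<close> to
    \<open>(1 + c) * (min_ratio_sum I + V)\<close>, which is at most
    \<open>2 * (1 + c) * OPT I\<close>.\<close>
  moreover have "c * V \<ge> 0" using c V by simp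
  moreover have "2 * scaling_strategy b I \<le> min_ratio_sum I + V + X"
    using scaling_strategy_le[OF b I] by (simp add: V_def X_def)
  ultimately have "scaling_strategy b I \<le> (1 + c) * OPT I"
    using OPT_ge[OF I, folded V_def] by (simp add: algebra_simps)
  then show "scaling_strategy b I \<le> scaling_bound b * OPT I"
    by (simp add: scaling_bound_eq[OF b] c_def)
qed

section \<open>Minimizing the bound over the base\<close>

lemma scaling_bound_3: "scaling_bound 3 = 1 + 3 * sqrt 3"
  by (simp add: scaling_bound_eq power3_eq_cube)

lemma scaling_bound_ge:
  assumes b: "b > 1"
  shows "scaling_bound 3 \<le> scaling_bound b"
proof -
  define x where "x = sqrt b"
  define y :: real where "y = sqrt 3"
  have x: "x > 1" "b = x\<^sup>2" using b by (simp_all add: x_def)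
  have y: "y \<ge> 0" "y * y = 3" by (simp_all add: y_def)
  \<comment> \<open>Clearing the denominator leaves the cubic
    \<open>2 * x ^ 3 - 3 * y * x\<^sup>2 + 3 * y\<close>. It has a double root at the minimizer
    \<open>x = y\<close>, since \<open>y ^ 3 = 3 * y\<close>.\<close>
  have "0 \<le> (x - y)\<^sup>2 * (2 * x + y)" using x y by simp
  also have "\<dots> = 2 * x ^ 3 - 3 * y * x\<^sup>2 + (y * y) * y"
    by (simp add: power2_eq_square power3_eq_cube algebra_simps)
  finally have "3 * y * (x\<^sup>2 - 1) \<le> 2 * x ^ 3"
    unfolding y(2) by (simp add: algebra_simps)
  moreover have "x\<^sup>2 - 1 > 0" using b x by simp
  ultimately have "3 * y \<le> 2 * x ^ 3 / (x\<^sup>2 - 1)" by (simp add: pos_le_divide_eq)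
  then show ?thesis
    unfolding scaling_bound_3 scaling_bound_eq[OF b] x_def[symmetric] y_def[symmetric]
    by (simp only: x(2)[symmetric] add_le_cancel_left)
qed

theorem theorem1p2:
  shows "(\<forall>b>1. competitive (scaling_bound b) (scaling_strategy b)) \<and>
         (\<forall>b>1. scaling_bound 3 \<le> scaling_bound b) \<and>
         scaling_bound 3 = 1 + 3 * sqrt 3 \<and>
         \<bar>1 + 3 * sqrt 3 - 6.196\<bar> < 0.0005"
proof -
  have "sqrt 3 > 1.732" by (rule real_less_rsqrt) (simp add: power2_eq_square)
  moreover have "sqrt 3 < 1.7321" by (rule real_less_lsqrt) (simp_all add: power2_eq_square)
  ultimately have "\<bar>1 + 3 * sqrt 3 - 6.196\<bar> < 0.0005" by (auto simp: abs_less_iff)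
  then show ?thesis
    using scaling_strategy_competitive scaling_bound_ge scaling_bound_3 by blast
qed

end
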